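(* Let $n\ge1$ and $s\ge0$, and assume either $n$ is even and $s\le n$, or $n$ is odd and $s\le n-1$. Let $e$ be the greatest even integer with $e\le s$. Then $$\max\{\operatorname{per}(I-A): A\in\omega_n^s\}=2^{e/2}\Big[1+\Big(\frac{s-e}{2}\Big)^2\Big].$$
   Context: An $n\times n$ matrix is doubly substochastic if all its entries are nonnegative and every row sum and column sum is at most $1$. $\sigma(A)$ is the sum of all entries of $A$, and $\omega_n^s$ is the set of $n\times n$ doubly substochastic matrices $A$ with $\sigma(A)=s$. The permanent is $\operatorname{per}(M)=\sum_{\pi\in S_n}\prod_i m_{i\pi(i)}$, and $I$ is the identity matrix. *)

theory Defs
  imports "HOL-Analysis.Analysis" "HOL-Combinatorics.Permutations"
begin

text \<open>n x n real matrices are represented as functions nat => nat => real;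
  only the entries with indices in {..<n} are relevant.\<close>

definition per :: "nat \<Rightarrow> (nat \<Rightarrow> nat \<Rightarrow> real) \<Rightarrow> real" where
  "per n M = (\<Sum>p | p permutes {..<n}. \<Prod>i<n. M i (p i))"

definition idm :: "nat \<Rightarrow> nat \<Rightarrow> real" where
  "idm i j = (if i = j then 1 else 0)"

definition sigma :: "nat \<Rightarrow> (nat \<Rightarrow> nat \<Rightarrow> real) \<Rightarrow> real" where
  "sigma n A = (\<Sum>i<n. \<Sum>j<n. A i j)"

definition doubly_substochastic :: "nat \<Rightarrow> (nat \<Rightarrow> nat \<Rightarrow> real) \<Rightarrow> bool" where
  "doubly_substochastic n A \<longleftrightarrow>
     (\<forall>i<n. \<forall>j<n. 0 \<le> A i j) \<and>
     (\<forall>i<n. (\<Sum>j<n. A i j) \<le> 1) \<and>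
     (\<forall>j<n. (\<Sum>i<n. A i j) \<le> 1)"

definition omega :: "nat \<Rightarrow> real \<Rightarrow> (nat \<Rightarrow> nat \<Rightarrow> real) set" where
  "omega n s = {A. doubly_substochastic n A \<and> sigma n A = s}"

end

theory Submission
  imports Defs
begin

text \<open>The column sums are irrelevant for the upper bound. The permanent is affine in each row, so
  \<open>per (I - A)\<close> is an average of permanents of matrices whose \<open>i\<close>-th row is
  \<open>e\<^sub>i - r\<^sub>i e\<^bsub>f i\<^esub>\<close>, where \<open>r\<^sub>i\<close> is the \<open>i\<close>-th row sum of \<open>A\<close> and \<open>f\<close> is a map of the index set to
  itself. Such a permanent is the product over the cycles of \<open>f\<close> of \<open>1 + \<Prod>(- r\<^sub>i)\<close>. An even cycle of
  total mass \<open>w\<close> contributes at most \<open>pair_bound (w / 2)\<close>, and \<open>pair_bound\<close> is supermultiplicative.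
  Equality is attained by diagonal blocks of size two with zero diagonal.\<close>

section \<open>Permanents over a finite index set and the elimination of an index\<close>

text \<open>The index set is arbitrary so that inductions can delete single indices.\<close>

definition perm :: "'a set \<Rightarrow> ('a \<Rightarrow> 'a \<Rightarrow> real) \<Rightarrow> real" where
  "perm S M = (\<Sum>p | p permutes S. \<Prod>i\<in>S. M i (p i))"

lemma perm_empty [simp]: "perm {} M = 1"
  by (simp add: perm_def)

lemma perm_cong:
  assumes "\<And>i j. i \<in> S \<Longrightarrow> j \<in> S \<Longrightarrow> M i j = N i j"
  shows "perm S M = perm S N"
  unfolding perm_def
  by (intro sum.cong prod.cong refl assms) (auto simp: permutes_in_image)

lemma perm_expand_row:
  assumes "finite S" "a \<notin> S"
  shows "perm (insert a S) M =
    (\<Sum>b\<in>insert a S. M a b * (\<Sum>q | q permutes S. \<Prod>x\<in>S. M x (Transposition.transpose a b (q x))))"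
proof -
  have "perm (insert a S) M = (\<Sum>b\<in>insert a S. \<Sum>q | q permutes S.
      \<Prod>i\<in>insert a S. M i ((Transposition.transpose a b \<circ> q) i))"
    unfolding perm_def by (rule sum_over_permutations_insert) (use assms in auto)
  also have "\<dots> = (\<Sum>b\<in>insert a S. \<Sum>q | q permutes S.
      M a b * (\<Prod>x\<in>S. M x (Transposition.transpose a b (q x))))"
    using assms by (intro sum.cong refl) (auto simp: permutes_not_in)
  finally show ?thesis by (simp add: sum_distrib_left)
qed

lemma perm_insert_diag_row:
  assumes "finite S" "a \<notin> S" "\<And>b. b \<in> S \<Longrightarrow> M a b = 0"
  shows "perm (insert a S) M = M a a * perm S M"
proof -
  have "perm (insert a S) M = (\<Sum>b\<in>{a}.
      M a b * (\<Sum>q | q permutes S. \<Prod>x\<in>S. M x (Transposition.transpose a b (q x))))"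
    unfolding perm_expand_row[OF assms(1,2)]
    by (rule sum.mono_neutral_right) (use assms in auto)
  then show ?thesis by (simp add: perm_def)
qed

text \<open>In a nonzero term either \<open>p j = j\<close>, or \<open>p j = k\<close> and
  \<open>p i = j\<close>. Bypassing \<open>j\<close> turns the second kind into a permutation of
  \<open>S\<close> sending \<open>i\<close> to \<open>k\<close>, so eliminating \<open>j\<close>
  only adds \<open>M i j * M j k\<close> to the entry at \<open>(i, k)\<close>.\<close>

lemma perm_contract:
  assumes fin: "finite S" and jS: "j \<notin> S" and i: "i \<in> S" and k: "k \<in> S"
    and row: "\<And>b. b \<in> S \<Longrightarrow> b \<noteq> k \<Longrightarrow> M j b = 0" and diag: "M j j = 1"
    and col: "\<And>x. x \<in> S \<Longrightarrow> x \<noteq> i \<Longrightarrow> M x j = 0"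
  shows "perm (insert j S) M =
    perm S (M(i := \<lambda>b. M i b + (if b = k then M i j * M j k else 0)))" (is "_ = perm S ?N")
proof -
  have jk: "j \<noteq> k" using jS k by auto
  define P where "P = (\<lambda>q. \<Prod>x\<in>S - {i}. M x (q x))"
  \<comment> \<open>The transposition redirects the preimage of \<open>k\<close> under
    \<open>q\<close> to \<open>j\<close>, where column \<open>j\<close> vanishes unless that
    preimage is \<open>i\<close>.\<close>
  have step: "(\<Prod>x\<in>S. M x (Transposition.transpose j k (q x))) = (if q i = k then M i j * P q else 0)"
    if q: "q permutes S" for q
  proof (cases "q i = k")
    case True
    have "M x (Transposition.transpose j k (q x)) = M x (q x)" if "x \<in> S - {i}" for x
    proof -
      have "q x \<noteq> k" using that True permutes_inj[OF q] by (auto dest: injD)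
      moreover have "q x \<noteq> j" using that q jS by (metis DiffD1 permutes_in_image)
      ultimately show ?thesis by (simp add: Transposition.transpose_def)
    qed
    then show ?thesis
      using fin i True by (simp add: prod.remove[of S i] P_def)
  next
    case False
    obtain x where x: "q x = k" using permutes_surj[OF q] by (metis surjD)
    then have xS: "x \<in> S" using q k by (metis permutes_in_image)
    have "M x (Transposition.transpose j k (q x)) = 0" using x False xS col by auto
    then show ?thesis using False fin xS by (auto intro!: prod_zero)
  qed
  have "perm (insert j S) M = (\<Sum>b\<in>{j,k}. M j b *
      (\<Sum>q | q permutes S. \<Prod>x\<in>S. M x (Transposition.transpose j b (q x))))"
    unfolding perm_expand_row[OF fin jS]
    by (rule sum.mono_neutral_right) (use fin k row in auto)
  also have "\<dots> = (\<Sum>q | q permutes S. \<Prod>x\<in>S. M x (q x))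
      + M j k * (\<Sum>q | q permutes S. if q i = k then M i j * P q else 0)"
    using jk diag step by simp
  also have "\<dots> = (\<Sum>q | q permutes S.
      (M i (q i) + (if q i = k then M i j * M j k else 0)) * P q)"
    unfolding sum_distrib_left sum.distrib[symmetric]
    by (intro sum.cong refl) (use fin i in \<open>auto simp: prod.remove[of S i] P_def algebra_simps\<close>)
  also have "\<dots> = perm S ?N"
    unfolding perm_def
  proof (intro sum.cong refl)
    fix q
    have "(\<Prod>x\<in>S - {i}. ?N x (q x)) = P q"
      unfolding P_def by (intro prod.cong) auto
    then show "(M i (q i) + (if q i = k then M i j * M j k else 0)) * P q = (\<Prod>x\<in>S. ?N x (q x))"
      using fin i by (simp add: prod.remove[of S i])
  qed
  finally show ?thesis .
qed

text \<open>The identity plus \<open>diag(c)\<close> times the 0/1 matrix of \<open>f\<close>. The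
  two terms are added, so a fixed point of \<open>f\<close> has diagonal entry
  \<open>1 + c i\<close>.\<close>

definition fun_mat :: "('a \<Rightarrow> 'a) \<Rightarrow> ('a \<Rightarrow> real) \<Rightarrow> 'a \<Rightarrow> 'a \<Rightarrow> real" where
  "fun_mat f c i j = (if j = i then 1 else 0) + (if j = f i then c i else 0)"

text \<open>The path \<open>i\<close>, \<open>j\<close>, \<open>f j\<close> in the graph of
  \<open>f\<close> is shortened to \<open>i\<close>, \<open>f j\<close>, and the coefficients
  multiply. If \<open>f j = i\<close>, then \<open>i\<close> becomes a fixed point.\<close>

lemma perm_fun_mat_contract:
  assumes "finite S" "j \<notin> S" "i \<in> S" "f i = j" "f j \<in> S"
    and "\<And>x. x \<in> S \<Longrightarrow> x \<noteq> i \<Longrightarrow> f x \<noteq> j"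
  shows "perm (insert j S) (fun_mat f c) = perm S (fun_mat (f(i := f j)) (c(i := c i * c j)))"
proof -
  have "perm (insert j S) (fun_mat f c) = perm S ((fun_mat f c)(i := \<lambda>b. fun_mat f c i b +
      (if b = f j then fun_mat f c i j * fun_mat f c j (f j) else 0)))"
  proof (rule perm_contract)
    show "fun_mat f c x j = 0" if "x \<in> S" "x \<noteq> i" for x
      using assms(2) assms(6)[OF that] that by (auto simp: fun_mat_def)
  qed (use assms in \<open>auto simp: fun_mat_def\<close>)
  also have "\<dots> = perm S (fun_mat (f(i := f j)) (c(i := c i * c j)))"
  proof (rule perm_cong)
    fix x y assume "x \<in> S" "y \<in> S"
    then have "y \<noteq> j" "j \<noteq> i" "f j \<noteq> j" using assms(2,3,5) by auto
    then show "((fun_mat f c)(i := \<lambda>b. fun_mat f c i b +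
        (if b = f j then fun_mat f c i j * fun_mat f c j (f j) else 0))) x y
      = fun_mat (f(i := f j)) (c(i := c i * c j)) x y"
      using assms(4) by (cases "x = i") (simp_all add: fun_mat_def)
  qed
  finally show ?thesis .
qed

section \<open>The bound as a function of half the mass\<close>

text \<open>The claimed maximum at \<open>s = 2 * x\<close>, for \<open>x\<close> nonnegative: the
  floor of \<open>x\<close> is e/2 and its fractional part is (s - e)/2.\<close>

definition pair_bound :: "real \<Rightarrow> real" where
  "pair_bound x = 2 ^ nat \<lfloor>x\<rfloor> * (1 + (frac x)\<^sup>2)"

lemma pair_bound_ge_1: "1 \<le> pair_bound x"
proof -
  have "1 * 1 \<le> (2::real) ^ nat \<lfloor>x\<rfloor> * (1 + (frac x)\<^sup>2)"
    by (intro mult_mono) auto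
  then show ?thesis by (simp add: pair_bound_def)
qed

text \<open>The integer parts contribute matching powers of two, so only the fractional parts
  \<open>a\<close> and \<open>b\<close> matter. Without a carry the claim reduces to
  \<open>(a * b)^2 \<le> 2 * (a * b)\<close>; with a carry one more factor 2 is available.\<close>

lemma pair_bound_supermult:
  assumes "0 \<le> x" "0 \<le> y"
  shows "pair_bound x * pair_bound y \<le> pair_bound (x + y)"
proof -
  define a b where "a = frac x" and "b = frac y"
  have ab: "0 \<le> a" "a < 1" "0 \<le> b" "b < 1" by (auto simp: a_def b_def frac_lt_1)
  have abl: "a * b \<le> 1" using ab by (simp add: mult_le_one)
  have fl: "0 \<le> \<lfloor>x\<rfloor>" "0 \<le> \<lfloor>y\<rfloor>" using assms by auto
  have eq: "pair_bound x * pair_bound y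
      = 2 ^ (nat \<lfloor>x\<rfloor> + nat \<lfloor>y\<rfloor>) * ((1 + a\<^sup>2) * (1 + b\<^sup>2))"
    by (simp add: pair_bound_def a_def b_def power_add)
  show ?thesis
  proof (cases "a + b < 1")
    case True
    have "a * b * (a * b) \<le> 2 * (a * b)"
      using ab abl by (intro mult_right_mono) auto
    then have "(1 + a\<^sup>2) * (1 + b\<^sup>2) \<le> 1 + (a + b)\<^sup>2"
      by (simp add: power2_eq_square algebra_simps)
    moreover have "pair_bound (x + y) = 2 ^ (nat \<lfloor>x\<rfloor> + nat \<lfloor>y\<rfloor>) * (1 + (a + b)\<^sup>2)"
      using True fl
      by (simp add: pair_bound_def a_def b_def frac_add floor_add nat_add_distrib)
    ultimately show ?thesis unfolding eq by (simp add: mult_left_mono)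
  next
    case False
    \<comment> \<open>This product is the difference of the two sides, the common power of two
      removed.\<close>
    have "0 \<le> (1 - a) * (1 - b) * (3 - a - b - a * b)"
      using ab abl by (intro mult_nonneg_nonneg) auto
    also have "\<dots> = 2 * (1 + (a + b - 1)\<^sup>2) - (1 + a\<^sup>2) * (1 + b\<^sup>2)"
      by (simp add: power2_eq_square algebra_simps)
    finally have "(1 + a\<^sup>2) * (1 + b\<^sup>2) \<le> 2 * (1 + (a + b - 1)\<^sup>2)" by simp
    moreover have "nat (\<lfloor>x\<rfloor> + \<lfloor>y\<rfloor> + 1) = Suc (nat \<lfloor>x\<rfloor> + nat \<lfloor>y\<rfloor>)"
      using fl by linarith
    then have "pair_bound (x + y) = 2 ^ (nat \<lfloor>x\<rfloor> + nat \<lfloor>y\<rfloor>) * (2 * (1 + (a + b - 1)\<^sup>2))"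
      using False
      by (simp add: pair_bound_def a_def b_def frac_add floor_add)
    ultimately show ?thesis unfolding eq by (simp only: mult_left_mono zero_le_power zero_le_numeral)
  qed
qed

lemma pair_bound_mono:
  assumes "0 \<le> x" "x \<le> y"
  shows "pair_bound x \<le> pair_bound y"
proof -
  have "pair_bound x * 1 \<le> pair_bound x * pair_bound (y - x)"
    by (intro mult_left_mono pair_bound_ge_1) (use pair_bound_ge_1[of x] in linarith)
  also have "\<dots> \<le> pair_bound y"
    using pair_bound_supermult[of x "y - x"] assms by simp
  finally show ?thesis by simp
qed

text \<open>AM-GM if \<open>u + v < 2\<close>; otherwise the right side is at least
  \<open>pair_bound 1 = 2\<close>, and the left side never exceeds 2.\<close>

lemma pair_bound_ge_mult:
  assumes "0 \<le> u" "0 \<le> v"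
  shows "1 + min 1 (u * v) \<le> pair_bound ((u + v) / 2)"
proof (cases "u + v < 2")
  case True
  then have "\<lfloor>(u + v) / 2\<rfloor> = 0" using assms by (simp add: floor_eq_iff)
  then have "pair_bound ((u + v) / 2) = 1 + ((u + v) / 2)\<^sup>2"
    by (simp add: pair_bound_def frac_def)
  moreover have "u * v \<le> ((u + v) / 2)\<^sup>2"
    using zero_le_power2[of "u - v"] by (simp add: power2_eq_square field_simps)
  ultimately show ?thesis by linarith
next
  case False
  have "2 = pair_bound 1" by (simp add: pair_bound_def)
  also have "\<dots> \<le> pair_bound ((u + v) / 2)"
    using False by (intro pair_bound_mono) auto
  finally show ?thesis by linarith
qed

text \<open>The invariant of the contraction: a node of mass \<open>w\<close> that stands for a contracted path.
  A path with an even number of nodes has \<open>c \<ge> 0\<close>; when it closes up it contributes the factor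
  \<open>1 + c\<close>.\<close>

definition admissible :: "real \<Rightarrow> real \<Rightarrow> bool" where
  "admissible c w \<longleftrightarrow> 0 \<le> w \<and> -1 \<le> c \<and> c \<le> 1 \<and> - c \<le> w \<and> 1 + c \<le> pair_bound (w / 2)"

text \<open>Two nonpositive coefficients are bounded by their masses, so
  \<open>a * b \<le> u * v\<close> and AM-GM applies. Two nonnegative ones have
  \<open>a * b \<le> a\<close>. For opposite signs \<open>1 + a * b \<le> 1\<close>, and the mass of
  the nonpositive factor bounds \<open>- (a * b)\<close>.\<close>

lemma admissible_mult:
  assumes "admissible a u" "admissible b v"
  shows "admissible (a * b) (u + v)"
proof -
  note A = assms[unfolded admissible_def]
  have uv: "0 \<le> u" "0 \<le> v" using A by auto
  have ab1: "\<bar>a\<bar> \<le> 1" "\<bar>b\<bar> \<le> 1" using A by auto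
  then have abs: "\<bar>a * b\<bar> \<le> 1" by (simp add: abs_mult mult_le_one)
  have le_a: "\<bar>a * b\<bar> \<le> \<bar>a\<bar>" using ab1 mult_left_le[of "\<bar>b\<bar>" "\<bar>a\<bar>"] by (simp add: abs_mult)
  have le_b: "\<bar>a * b\<bar> \<le> \<bar>b\<bar>" using ab1 mult_left_le[of "\<bar>a\<bar>" "\<bar>b\<bar>"] by (simp add: abs_mult mult.commute)
  have mono: "pair_bound (u / 2) \<le> pair_bound ((u + v) / 2)"
    using uv by (intro pair_bound_mono) auto
  have ge1: "1 \<le> pair_bound ((u + v) / 2)" by (rule pair_bound_ge_1)
  consider "a \<le> 0" "b \<le> 0" | "0 \<le> a" "0 \<le> b" | "a \<le> 0" "0 \<le> b" | "0 \<le> a" "b \<le> 0"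
    by linarith
  then have "- (a * b) \<le> u + v \<and> 1 + a * b \<le> pair_bound ((u + v) / 2)"
  proof cases
    case 1
    then have nn: "0 \<le> a * b" by (simp add: mult_nonpos_nonpos)
    have "(- a) * (- b) \<le> u * v" using 1 A by (intro mult_mono) auto
    then have "1 + a * b \<le> 1 + min 1 (u * v)" using abs by simp
    also have "\<dots> \<le> pair_bound ((u + v) / 2)"
      by (rule pair_bound_ge_mult) (use uv in auto)
    finally show ?thesis using nn uv by auto
  next
    case 2
    then have "0 \<le> a * b" by simp
    then show ?thesis using le_a 2 A mono uv by linarith
  next
    case 3
    then have "a * b \<le> 0" by (simp add: mult_nonpos_nonneg)
    then show ?thesis using le_a 3 A ge1 uv by linarith
  next
    case 4
    then have "a * b \<le> 0" by (simp add: mult_nonneg_nonpos)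
    then show ?thesis using le_b 4 A ge1 uv by linarith
  qed
  then show ?thesis using abs uv by (auto simp: admissible_def)
qed

section \<open>Upper bound: matrices of maps, then general rows\<close>

text \<open>Each induction step removes one index \<open>j\<close>: it is dropped if it has no
  preimage, split off as a factor if it is fixed, and otherwise merged into its predecessor.\<close>

lemma perm_fun_mat_le:
  assumes "finite S" "\<And>x. x \<in> S \<Longrightarrow> f x \<in> S" "\<And>x. x \<in> S \<Longrightarrow> admissible (c x) (w x)"
  shows "perm S (fun_mat f c) \<le> pair_bound ((\<Sum>x\<in>S. w x) / 2)"
  using assms
proof (induction "card S" arbitrary: S f c w)
  case 0
  then show ?case using pair_bound_ge_1 by simp
next
  case (Suc n)
  have w0: "0 \<le> w x" if "x \<in> S" for x using Suc.prems(3)[OF that] by (simp add: admissible_def)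
  show ?case
  proof (cases "f ` S = S")
    case False
    then obtain j where j: "j \<in> S" "j \<notin> f ` S" using Suc.prems(2) by blast
    define S' where "S' = S - {j}"
    have S': "S = insert j S'" "j \<notin> S'" "finite S'" "card S' = n"
      using j Suc.hyps(2)[symmetric] Suc.prems(1) by (auto simp: S'_def)
    have fS: "f x \<in> S'" if "x \<in> S" for x using that j Suc.prems(2) by (auto simp: S'_def)
    \<comment> \<open>Here \<open>f j\<close> serves both as \<open>i\<close> and as
      \<open>k\<close>. Since \<open>j\<close> has no preimage, the entry at \<open>(f j, j)\<close>
      is zero and the correction vanishes.\<close>
    have "perm S (fun_mat f c) = perm S' ((fun_mat f c)(f j := \<lambda>b. fun_mat f c (f j) b +
        (if b = f j then fun_mat f c (f j) j * fun_mat f c j (f j) else 0)))"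
      unfolding S'(1)
      by (rule perm_contract) (use S' fS j in \<open>auto simp: fun_mat_def\<close>)
    also have "\<dots> = perm S' (fun_mat f c)"
      by (rule perm_cong) (use S' fS j in \<open>auto simp: fun_mat_def\<close>)
    also have "\<dots> \<le> pair_bound ((\<Sum>x\<in>S'. w x) / 2)"
      by (rule Suc.hyps(1)) (use S' fS Suc.prems in auto)
    also have "\<dots> \<le> pair_bound ((\<Sum>x\<in>S. w x) / 2)"
      by (rule pair_bound_mono) (use w0 S' in \<open>auto intro!: sum_nonneg\<close>)
    finally show ?thesis .
  next
    case surj: True
    then have inj: "inj_on f S" using Suc.prems(1) by (simp add: eq_card_imp_inj_on)
    obtain j where j: "j \<in> S" using Suc.hyps(2) by (metis card.empty ex_in_conv nat.distinct(1))
    define S' where "S' = S - {j}"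
    have S': "S = insert j S'" "j \<notin> S'" "finite S'" "card S' = n"
      using j Suc.hyps(2)[symmetric] Suc.prems(1) by (auto simp: S'_def)
    show ?thesis
    proof (cases "f j = j")
      case True
      have fS: "f x \<in> S'" if "x \<in> S'" for x
        using that True inj_onD[OF inj _ _ j, of x] Suc.prems(2)[of x] by (auto simp: S'_def)
      have adm: "-1 \<le> c j" "1 + c j \<le> pair_bound (w j / 2)"
        using Suc.prems(3)[OF j] by (auto simp: admissible_def)
      have "perm S (fun_mat f c) = fun_mat f c j j * perm S' (fun_mat f c)"
        unfolding S'(1)
        by (rule perm_insert_diag_row) (use S' True in \<open>auto simp: fun_mat_def\<close>)
      also have "\<dots> = (1 + c j) * perm S' (fun_mat f c)"
        using True by (simp add: fun_mat_def)
      also have "\<dots> \<le> (1 + c j) * pair_bound ((\<Sum>x\<in>S'. w x) / 2)"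
        by (rule mult_left_mono[OF Suc.hyps(1)]) (use S' fS adm Suc.prems in auto)
      also have "\<dots> \<le> pair_bound (w j / 2) * pair_bound ((\<Sum>x\<in>S'. w x) / 2)"
        by (rule mult_right_mono) (use adm pair_bound_ge_1[of "(\<Sum>x\<in>S'. w x) / 2"] in auto)
      also have "\<dots> \<le> pair_bound (w j / 2 + (\<Sum>x\<in>S'. w x) / 2)"
        by (rule pair_bound_supermult) (use w0 S' in \<open>auto intro!: sum_nonneg\<close>)
      also have "w j / 2 + (\<Sum>x\<in>S'. w x) / 2 = (\<Sum>x\<in>S. w x) / 2"
        unfolding S'(1) using S'(2,3) by (simp add: add_divide_distrib)
      finally show ?thesis .
    next
      \<comment> \<open>Now \<open>j\<close> has a unique predecessor \<open>i\<close>, different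
        from \<open>j\<close>. Merging \<open>j\<close> into \<open>i\<close> adds their masses, so
        the total is unchanged.\<close>
      case False
      obtain i where i: "i \<in> S" "f i = j" using surj j by (metis imageE)
      have iS: "i \<in> S'" and kS: "f j \<in> S'"
        using i False j Suc.prems(2) by (auto simp: S'_def)
      have uniq: "f x \<noteq> j" if "x \<in> S'" "x \<noteq> i" for x
        using that i inj_onD[OF inj _ _ i(1), of x] by (auto simp: S'_def)
      have "perm S (fun_mat f c) = perm S' (fun_mat (f(i := f j)) (c(i := c i * c j)))"
        unfolding S'(1)
        by (rule perm_fun_mat_contract) (use S' iS kS i uniq in auto)
      also have "\<dots> \<le> pair_bound ((\<Sum>x\<in>S'. (w(i := w i + w j)) x) / 2)"
      proof (rule Suc.hyps(1))
        show "(f(i := f j)) x \<in> S'" if "x \<in> S'" for x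
          using that kS uniq Suc.prems(2)[of x] by (auto simp: S'_def)
        show "admissible ((c(i := c i * c j)) x) ((w(i := w i + w j)) x)" if "x \<in> S'" for x
          using that i j Suc.prems(3) by (auto simp: S'_def intro: admissible_mult)
      qed (use S' in auto)
      also have "(\<Sum>x\<in>S'. (w(i := w i + w j)) x) = (\<Sum>x\<in>S. w x)"
      proof -
        have "(\<Sum>x\<in>S' - {i}. (w(i := w i + w j)) x) = (\<Sum>x\<in>S' - {i}. w x)"
          by (rule sum.cong) auto
        then have "(\<Sum>x\<in>S'. (w(i := w i + w j)) x) = w j + (w i + (\<Sum>x\<in>S' - {i}. w x))"
          using sum.remove[OF S'(3) iS, of "w(i := w i + w j)"] by simp
        also have "\<dots> = w j + (\<Sum>x\<in>S'. w x)"
          using sum.remove[OF S'(3) iS, of w] by simp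
        also have "\<dots> = (\<Sum>x\<in>S. w x)"
          unfolding S'(1) using S'(2,3) by simp
        finally show ?thesis .
      qed
      finally show ?thesis .
    qed
  qed
qed

lemma perm_substochastic_le:
  assumes fin: "finite S" and nn: "\<And>i j. i \<in> S \<Longrightarrow> j \<in> S \<Longrightarrow> 0 \<le> A i j"
    and row: "\<And>i. i \<in> S \<Longrightarrow> (\<Sum>j\<in>S. A i j) \<le> 1"
  shows "perm S (\<lambda>i j. (if i = j then 1 else 0) - A i j)
    \<le> pair_bound ((\<Sum>i\<in>S. \<Sum>j\<in>S. A i j) / 2)"
proof -
  define r where "r i = (\<Sum>j\<in>S. A i j)" for i
  \<comment> \<open>Row \<open>i\<close> of \<open>L\<close> is a probability vector. If
    \<open>r i = 0\<close>, any such vector would do; the point mass at \<open>i\<close> is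
    chosen.\<close>
  define L where "L i j = (if r i = 0 then if j = i then 1 else 0 else A i j / r i)" for i j
  have r0: "0 \<le> r i" if "i \<in> S" for i using that nn by (auto simp: r_def intro: sum_nonneg)
  have L0: "0 \<le> L i j" if "i \<in> S" "j \<in> S" for i j
    using that nn r0 by (auto simp: L_def)
  have L1: "(\<Sum>j\<in>S. L i j) = 1" if "i \<in> S" for i
  proof (cases "r i = 0")
    case True
    then show ?thesis using that fin by (simp add: L_def)
  next
    case False
    then have "(\<Sum>j\<in>S. L i j) = r i / r i"
      by (simp add: L_def r_def flip: sum_divide_distrib)
    then show ?thesis using False by simp
  qed
  have AL: "A i j = r i * L i j" if "i \<in> S" "j \<in> S" for i j
    using that nn fin by (auto simp: L_def r_def sum_nonneg_eq_0_iff)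
  have mix: "(if i = b then 1 else 0) - A i b =
      (\<Sum>j\<in>S. L i j * ((if b = i then 1 else 0) + (if b = j then - r i else 0)))"
    if "i \<in> S" "b \<in> S" for i b
  proof -
    have "(\<Sum>j\<in>S. L i j * ((if b = i then 1 else 0) + (if b = j then - r i else 0)))
        = (\<Sum>j\<in>S. L i j) * (if b = i then 1 else 0) + (\<Sum>j\<in>S. if b = j then - (r i * L i j) else 0)"
      unfolding sum_distrib_right sum.distrib[symmetric]
      by (intro sum.cong) (auto simp: algebra_simps)
    then show ?thesis using that L1 AL fin by auto
  qed
  have "perm S (\<lambda>i j. (if i = j then 1 else 0) - A i j) =
      (\<Sum>p | p permutes S. \<Prod>i\<in>S. \<Sum>j\<in>S. L i j *
        ((if p i = i then 1 else 0) + (if p i = j then - r i else 0)))"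
    unfolding perm_def by (intro sum.cong prod.cong refl mix) (auto simp: permutes_in_image)
  \<comment> \<open>Expanding the product of row sums yields a sum over all maps \<open>f\<close>
    from \<open>S\<close> to itself.\<close>
  also have "\<dots> = (\<Sum>p | p permutes S. \<Sum>f\<in>PiE S (\<lambda>_. S).
      (\<Prod>i\<in>S. L i (f i)) * (\<Prod>i\<in>S. fun_mat f (\<lambda>i. - r i) i (p i)))"
    using fin by (simp add: prod_sum_PiE fun_mat_def prod.distrib)
  also have "\<dots> = (\<Sum>f\<in>PiE S (\<lambda>_. S). (\<Prod>i\<in>S. L i (f i)) * perm S (fun_mat f (\<lambda>i. - r i)))"
    unfolding perm_def sum_distrib_left by (rule sum.swap)
  \<comment> \<open>The bound depends only on the total mass, hence is the same for every
    \<open>f\<close>; the weights then sum to 1.\<close>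
  also have "\<dots> \<le> (\<Sum>f\<in>PiE S (\<lambda>_. S). (\<Prod>i\<in>S. L i (f i)) * pair_bound ((\<Sum>i\<in>S. r i) / 2))"
  proof (intro sum_mono mult_left_mono prod_nonneg perm_fun_mat_le)
    show "admissible (- r x) (r x)" if "x \<in> S" for x
      using that r0[OF that] row[OF that] pair_bound_ge_1[of "r x / 2"]
      unfolding admissible_def r_def by linarith
  qed (use fin L0 in \<open>auto simp: PiE_iff\<close>)
  also have "\<dots> = (\<Prod>i\<in>S. \<Sum>j\<in>S. L i j) * pair_bound ((\<Sum>i\<in>S. r i) / 2)"
    using fin by (simp add: prod_sum_PiE sum_distrib_right)
  also have "\<dots> = pair_bound ((\<Sum>i\<in>S. r i) / 2)"
    using L1 by simp
  finally show ?thesis by (simp add: r_def)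
qed

section \<open>Matrices attaining the bound\<close>

definition flip :: "nat \<Rightarrow> nat" where
  "flip i = (if even i then Suc i else i - 1)"

lemma flip_flip [simp]: "flip (flip i) = i"
  by (auto simp: flip_def)

text \<open>Contracting \<open>2 * m + 1\<close> into \<open>2 * m\<close> leaves a fixed point
  whose coefficient is the product of the two; it splits off as a factor.\<close>

lemma perm_flip:
  "perm {..<2 * m} (fun_mat flip c) = (\<Prod>l<m. 1 + c (2 * l) * c (Suc (2 * l)))"
proof (induction m)
  case 0
  then show ?case by simp
next
  case (Suc m)
  let ?S = "{..<2 * m}" and ?i = "2 * m" and ?j = "Suc (2 * m)"
  let ?f = "flip(?i := ?i)" and ?c = "c(?i := c ?i * c ?j)"
  have lt: "flip x < 2 * m" if "x < 2 * m" for x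
    using that by (auto simp: flip_def elim!: evenE)
  have ij: "flip ?i = ?j" "flip ?j = ?i" by (auto simp: flip_def)
  have "perm {..<2 * Suc m} (fun_mat flip c) = perm (insert ?j (insert ?i ?S)) (fun_mat flip c)"
    by (rule arg_cong2[where f = perm]) auto
  also have "\<dots> = perm (insert ?i ?S) (fun_mat (flip(?i := flip ?j)) ?c)"
  proof (rule perm_fun_mat_contract)
    show "flip x \<noteq> ?j" if "x \<in> insert ?i ?S" "x \<noteq> ?i" for x
      using that lt[of x] by auto
  qed (auto simp: ij)
  also have "\<dots> = fun_mat ?f ?c ?i ?i * perm ?S (fun_mat ?f ?c)"
    unfolding ij by (rule perm_insert_diag_row) (auto simp: fun_mat_def)
  also have "perm ?S (fun_mat ?f ?c) = perm ?S (fun_mat flip c)"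
    by (rule perm_cong) (auto simp: fun_mat_def)
  finally show ?case by (simp add: Suc fun_mat_def)
qed

text \<open>Block diagonal: \<open>m\<close> blocks [[0,1],[1,0]], each giving a factor 2, then one
  block [[0,u],[u,0]] giving \<open>1 + u^2\<close>, then zeros.\<close>

definition extremal :: "nat \<Rightarrow> real \<Rightarrow> nat \<Rightarrow> nat \<Rightarrow> real" where
  "extremal m u i j = (if j = flip i then if i < 2 * m then 1 else if i < 2 * m + 2 then u else 0 else 0)"

lemma extremal_attains:
  assumes u: "0 \<le> u" "u \<le> 1" and n: "2 * m \<le> n" "u = 0 \<or> 2 * m + 2 \<le> n"
  shows "extremal m u \<in> omega n (2 * (real m + u))"
    and "per n (\<lambda>i j. idm i j - extremal m u i j) = 2 ^ m * (1 + u\<^sup>2)"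
proof -
  define r where "r i = (if i < 2 * m then 1 else if i < 2 * m + 2 then u else 0)" for i
  have E: "extremal m u i j = (if j = flip i then r i else 0)" for i j
    by (simp add: extremal_def r_def)
  \<comment> \<open>Since \<open>flip\<close> is an involution, each column also has at most one
    nonzero entry.\<close>
  have E': "extremal m u i j = (if i = flip j then r (flip j) else 0)" for i j
    unfolding E by (metis flip_flip)
  have r01: "0 \<le> r i" "r i \<le> 1" for i using u by (auto simp: r_def)
  have flt: "flip i < n" if "i < n" "r i \<noteq> 0" for i
  proof -
    have "i < 2 * m + 2" "2 * m + 2 \<le> n \<or> i < 2 * m" using that n by (auto simp: r_def split: if_splits)
    then show ?thesis using n by (auto simp: flip_def elim!: evenE) presburger+
  qed
  have row: "(\<Sum>j<n. extremal m u i j) = r i" if "i < n" for i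
    using flt[OF that] by (auto simp: E)
  have col: "(\<Sum>i<n. extremal m u i j) \<le> 1" for j
    using r01 by (simp add: E')
  have "sigma n (extremal m u) = (\<Sum>i<n. r i)" by (simp add: sigma_def row)
  \<comment> \<open>If \<open>u = 0\<close>, then \<open>2 * m + 2\<close> may exceed
    \<open>n\<close>, but the extra terms are zero.\<close>
  also have "\<dots> = (\<Sum>i<2 * m + 2. r i)"
  proof (cases "u = 0")
    case True
    have "(\<Sum>i<n. r i) = (\<Sum>i<2 * m. r i)"
      by (rule sum.mono_neutral_right) (use n True in \<open>auto simp: r_def\<close>)
    then show ?thesis using True by (simp add: r_def)
  next
    case False
    show ?thesis by (rule sum.mono_neutral_right) (use n False in \<open>auto simp: r_def\<close>)
  qed
  also have "\<dots> = 2 * (real m + u)" by (simp add: r_def)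
  finally show "extremal m u \<in> omega n (2 * (real m + u))"
    using row col r01 by (auto simp: omega_def doubly_substochastic_def E)
  define k where "k = n div 2"
  let ?M = "fun_mat flip (\<lambda>i. - r i)"
  have "per n (\<lambda>i j. idm i j - extremal m u i j) = perm {..<n} ?M"
    unfolding per_def perm_def by (intro sum.cong prod.cong refl) (auto simp: idm_def fun_mat_def E)
  also have "\<dots> = perm {..<2 * k} ?M"
  proof (cases "even n")
    case True
    then show ?thesis by (simp add: k_def)
  next
    case False
    then have nk: "n = Suc (2 * k)" by (simp add: k_def)
    \<comment> \<open>The partner of the last index lies outside the index set, so the last row is a
      unit row.\<close>
    have "flip (2 * k) = Suc (2 * k)" by (simp add: flip_def)
    then have "perm (insert (2 * k) {..<2 * k}) ?M = ?M (2 * k) (2 * k) * perm {..<2 * k} ?M"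
      by (intro perm_insert_diag_row) (auto simp: fun_mat_def)
    then show ?thesis using nk by (simp add: lessThan_Suc fun_mat_def flip_def)
  qed
  also have "\<dots> = (\<Prod>l<k. 1 + r (2 * l) * r (Suc (2 * l)))"
    by (simp add: perm_flip)
  also have "\<dots> = (\<Prod>l<Suc m. 1 + r (2 * l) * r (Suc (2 * l)))"
  proof (cases "u = 0")
    case True
    have "(\<Prod>l<k. 1 + r (2 * l) * r (Suc (2 * l))) = (\<Prod>l<m. 1 + r (2 * l) * r (Suc (2 * l)))"
      by (rule prod.mono_neutral_right) (use n True in \<open>auto simp: r_def k_def\<close>)
    then show ?thesis using True by (simp add: r_def)
  next
    case False
    show ?thesis by (rule prod.mono_neutral_right) (use n False in \<open>auto simp: r_def k_def\<close>)
  qed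
  also have "\<dots> = 2 ^ m * (1 + u\<^sup>2)" by (simp add: r_def power2_eq_square)
  finally show "per n (\<lambda>i j. idm i j - extremal m u i j) = 2 ^ m * (1 + u\<^sup>2)" .
qed

section \<open>The maximum\<close>

theorem mainTheorem13:
  fixes n :: nat and s :: real and e :: int
  assumes "n \<ge> 1" and "s \<ge> 0"
    and "(even n \<and> s \<le> real n) \<or> (odd n \<and> s \<le> real n - 1)"
    and "even e" and "real_of_int e \<le> s"
    and "\<forall>k::int. even k \<and> real_of_int k \<le> s \<longrightarrow> k \<le> e"
  shows "(2 powr (real_of_int e / 2)) * (1 + ((s - real_of_int e) / 2)^2)
           \<in> (\<lambda>A. per n (\<lambda>i j. idm i j - A i j)) ` omega n s
         \<and> (\<forall>A\<in>omega n s. per n (\<lambda>i j. idm i j - A i j)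
               \<le> (2 powr (real_of_int e / 2)) * (1 + ((s - real_of_int e) / 2)^2))"
proof -
  \<comment> \<open>Zero is an even integer not exceeding \<open>s\<close>.\<close>
  have "0 \<le> e" using assms(2,6) by auto
  define m where "m = nat (e div 2)"
  have e: "e = 2 * int m" using \<open>0 \<le> e\<close> assms(4) by (simp add: m_def)
  define u where "u = s / 2 - real m"
  \<comment> \<open>Maximality of \<open>e\<close>, tested at the next even integer, forces
    \<open>u < 1\<close>.\<close>
  have "\<not> real_of_int (e + 2) \<le> s" using assms(4) assms(6)[rule_format, of "e + 2"] by auto
  then have u: "0 \<le> u" "u < 1" using assms(5) e by (auto simp: u_def)
  have fl: "\<lfloor>s / 2\<rfloor> = int m" using u by (simp add: u_def floor_eq_iff)
  have s: "s = 2 * (real m + u)" by (simp add: u_def)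
  have val: "(2 powr (real_of_int e / 2)) * (1 + ((s - real_of_int e) / 2)^2) = 2 ^ m * (1 + u\<^sup>2)"
    by (simp add: e s powr_realpow)
  have val': "pair_bound (s / 2) = 2 ^ m * (1 + u\<^sup>2)"
    by (simp add: pair_bound_def fl frac_def u_def)
  \<comment> \<open>Both parity cases become \<open>s \<le> 2 * k\<close>. Hence the block with
    entry \<open>u\<close> fits unless \<open>u = 0\<close>.\<close>
  obtain k where k: "n = 2 * k \<or> n = Suc (2 * k)" by (metis evenE oddE Suc_eq_plus1)
  then have sk: "s \<le> 2 * real k" using assms(3) by auto
  have "real m + u \<le> real k" using sk by (simp add: u_def)
  then have "m \<le> k" "u = 0 \<or> m < k" using u by auto
  then have n: "2 * m \<le> n" "u = 0 \<or> 2 * m + 2 \<le> n" using k by auto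
  have "2 ^ m * (1 + u\<^sup>2) \<in> (\<lambda>A. per n (\<lambda>i j. idm i j - A i j)) ` omega n s"
    using extremal_attains[OF u(1) less_imp_le[OF u(2)] n, folded s]
    by (intro image_eqI[of _ _ "extremal m u"]) (simp_all only:)
  moreover have "per n (\<lambda>i j. idm i j - A i j) \<le> 2 ^ m * (1 + u\<^sup>2)" if "A \<in> omega n s" for A
  proof -
    have "per n (\<lambda>i j. idm i j - A i j) = perm {..<n} (\<lambda>i j. (if i = j then 1 else 0) - A i j)"
      by (simp add: per_def perm_def idm_def)
    also have "\<dots> \<le> pair_bound ((\<Sum>i<n. \<Sum>j<n. A i j) / 2)"
      by (rule perm_substochastic_le) (use that in \<open>auto simp: omega_def doubly_substochastic_def\<close>)
    also have "(\<Sum>i<n. \<Sum>j<n. A i j) = s"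
      using that by (simp add: omega_def sigma_def)
    finally show ?thesis using val' by simp
  qed
  ultimately show ?thesis unfolding val by blast
qed

end
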